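(* Let $n\ge 3$, let $(T,+,\Gamma,\mu)$ be a (possibly non-commutative) $n$-ary $\Gamma$-semiring, and let $P$ be a proper two-sided ideal of $T$. The following are equivalent: (1) $P$ is $n$-ary prime; (2) the quotient $T/P$ has no non-zero $n$-ary two-sided zero-divisors, i.e. for all $x_1,\dots,x_n\in T$ and $\alpha_1,\dots,\alpha_{n-1}\in\Gamma$, $\mu(\bar x_1,\alpha_1,\ldots,\alpha_{n-1},\bar x_n)=\bar 0$ implies $\bar x_i=\bar 0$ for some $i$, where bars denote residue classes in $T/P$.
   Context: $\Gamma$ is an additive semigroup and $(T,+)$ a commutative additive semigroup with identity $0$. An $n$-ary $\Gamma$-semiring is $(T,+,\Gamma,\mu)$ with $\mu:T^n\times\Gamma^{n-1}\to T$, written $\mu(x_1,\alpha_1,x_2,\ldots,\alpha_{n-1},x_n)$, additive in each $T$-variable, $0$-absorbing in each $T$-position (the value is $0$ if some $x_i=0$), and $n$-ary associative: any two legal bracketings by $\mu$ of the same word $x_1\alpha_1x_2\alpha_2\cdots x_N$ give the same element. A two-sided ideal of $T$ is an $(n,1)$-ideal: a nonempty $I\subseteq T$ closed under $+$ such that $\mu(x_1,\alpha_1,\ldots,\alpha_{n-1},x_n)\in I$ whenever at least one $x_i\in I$. It is proper if $I\neq T$. A proper $(n,1)$-ideal $P$ is $n$-ary prime if $\mu(x_1,\alpha_1,\ldots,\alpha_{n-1},x_n)\in P$ implies $x_i\in P$ for some $i$ (for all $x_i\in T$, $\alpha_j\in\Gamma$). Convention: $\mu(\bar x_1,\alpha_1,\ldots,\alpha_{n-1},\bar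 x_n)$ denotes the class of $\mu(x_1,\alpha_1,\ldots,\alpha_{n-1},x_n)$, and $\bar x=\bar 0$ in $T/P$ means $x\in P$. *)

theory Defs
  imports Main
begin

text \<open>
  The carriers are types: the commutative additive monoid is a type of class
  \<^class>\<open>comm_monoid_add\<close>, and the additive semigroup of parameters is a type of class
  \<^class>\<open>semigroup_add\<close>. The value of the operation at
  \<open>x\<^sub>1, \<alpha>\<^sub>1, x\<^sub>2, ..., \<alpha>\<^sub>n\<^sub>-\<^sub>1, x\<^sub>n\<close> is written \<open>\<mu> [x\<^sub>1, ..., x\<^sub>n] [\<alpha>\<^sub>1, ..., \<alpha>\<^sub>n\<^sub>-\<^sub>1]\<close>;
  values of \<open>\<mu>\<close> at lists of other lengths carry no meaning, and every condition below
  is restricted to lists of lengths \<open>n\<close> and \<open>n - 1\<close>.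
\<close>

datatype ('a, 'g) bracketing =
  Letter 'a
| Bracket "('a, 'g) bracketing list" "'g list"

primrec legal :: "nat \<Rightarrow> ('a, 'g) bracketing \<Rightarrow> bool" where
  "legal n (Letter x) \<longleftrightarrow> True"
| "legal n (Bracket ts gs) \<longleftrightarrow>
     length ts = n \<and> length gs = n - 1 \<and> (\<forall>b \<in> set (map (legal n) ts). b)"

primrec bracketing_value :: "('a list \<Rightarrow> 'g list \<Rightarrow> 'a) \<Rightarrow> ('a, 'g) bracketing \<Rightarrow> 'a" where
  "bracketing_value \<mu> (Letter x) = x"
| "bracketing_value \<mu> (Bracket ts gs) = \<mu> (map (bracketing_value \<mu>) ts) gs"

fun weave :: "('a + 'g) list list \<Rightarrow> 'g list \<Rightarrow> ('a + 'g) list" where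
  "weave (w # v # ws) (g # gs) = w @ Inr g # weave (v # ws) gs"
| "weave ws gs = concat ws"

text \<open>The underlying word \<open>x\<^sub>1\<alpha>\<^sub>1x\<^sub>2\<alpha>\<^sub>2...x\<^sub>N\<close>: elements are tagged \<^const>\<open>Inl\<close>, parameters \<^const>\<open>Inr\<close>.\<close>

primrec word :: "('a, 'g) bracketing \<Rightarrow> ('a + 'g) list" where
  "word (Letter x) = [Inl x]"
| "word (Bracket ts gs) = weave (map word ts) gs"

locale nary_gamma_semiring =
  fixes n :: nat
    and \<mu> :: "'a::comm_monoid_add list \<Rightarrow> 'g::semigroup_add list \<Rightarrow> 'a"
  assumes additive:
      "\<And>xs gs i a b. \<lbrakk>length xs = n; length gs = n - 1; i < n\<rbrakk> \<Longrightarrow>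
         \<mu> (xs[i := a + b]) gs = \<mu> (xs[i := a]) gs + \<mu> (xs[i := b]) gs"
    and absorbing:
      "\<And>xs gs. \<lbrakk>length xs = n; length gs = n - 1; 0 \<in> set xs\<rbrakk> \<Longrightarrow> \<mu> xs gs = 0"
    and associative:
      "\<And>s t. \<lbrakk>legal n s; legal n t; word s = word t\<rbrakk> \<Longrightarrow>
         bracketing_value \<mu> s = bracketing_value \<mu> t"

definition two_sided_ideal ::
  "nat \<Rightarrow> ('a::comm_monoid_add list \<Rightarrow> 'g::semigroup_add list \<Rightarrow> 'a) \<Rightarrow> 'a set \<Rightarrow> bool" where
  "two_sided_ideal n \<mu> I \<longleftrightarrow>
     I \<noteq> {} \<and>
     (\<forall>x\<in>I. \<forall>y\<in>I. x + y \<in> I) \<and>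
     (\<forall>xs gs. length xs = n \<and> length gs = n - 1 \<and> (\<exists>i<n. xs ! i \<in> I) \<longrightarrow> \<mu> xs gs \<in> I)"

definition proper_two_sided_ideal ::
  "nat \<Rightarrow> ('a::comm_monoid_add list \<Rightarrow> 'g::semigroup_add list \<Rightarrow> 'a) \<Rightarrow> 'a set \<Rightarrow> bool" where
  "proper_two_sided_ideal n \<mu> I \<longleftrightarrow> two_sided_ideal n \<mu> I \<and> I \<noteq> UNIV"

definition nary_prime ::
  "nat \<Rightarrow> ('a::comm_monoid_add list \<Rightarrow> 'g::semigroup_add list \<Rightarrow> 'a) \<Rightarrow> 'a set \<Rightarrow> bool" where
  "nary_prime n \<mu> P \<longleftrightarrow>
     proper_two_sided_ideal n \<mu> P \<and>
     (\<forall>xs gs. length xs = n \<and> length gs = n - 1 \<and> \<mu> xs gs \<in> P \<longrightarrow> (\<exists>i<n. xs ! i \<in> P))"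

text \<open>
  \<open>residue_congruence n \<mu> P E\<close> says that the classes of \<open>E\<close> can serve as the residue classes
  of \<open>T/P\<close>: the class of \<open>\<mu>(x\<^sub>1, \<alpha>\<^sub>1, ..., x\<^sub>n)\<close> depends only on the classes of the \<open>x\<^sub>i\<close>, and the
  zero class is \<open>P\<close>. For every ideal \<open>P\<close> such an \<open>E\<close> exists
  (\<open>ex_residue_congruence\<close> below); if \<open>P\<close> is subtractive, the Bourne congruence
  \<open>\<exists>p\<in>P. \<exists>q\<in>P. x + p = y + q\<close> is one (\<open>residue_congruence_bourne\<close> below).
  Compatibility with \<open>+\<close> is deliberately not demanded: it would force \<open>P\<close> to be
  subtractive (\<open>x + p \<in> P\<close> and \<open>p \<in> P\<close> would imply \<open>x \<in> P\<close>), which is not assumed of an ideal.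
\<close>

definition residue_congruence ::
  "nat \<Rightarrow> ('a::comm_monoid_add list \<Rightarrow> 'g::semigroup_add list \<Rightarrow> 'a) \<Rightarrow> 'a set \<Rightarrow> ('a \<times> 'a) set \<Rightarrow> bool"
where
  "residue_congruence n \<mu> P E \<longleftrightarrow>
     equiv UNIV E \<and>
     (\<forall>xs ys gs. length xs = n \<and> length ys = n \<and> length gs = n - 1 \<and>
        (\<forall>i<n. (xs ! i, ys ! i) \<in> E) \<longrightarrow> (\<mu> xs gs, \<mu> ys gs) \<in> E) \<and>
     E `` {0} = P"

definition residue_class :: "('a \<times> 'a) set \<Rightarrow> 'a \<Rightarrow> 'a set" where
  "residue_class E x = E `` {x}"

text \<open>
  The operation induced on residue classes, as a union over all choices of representatives;
  for a congruence all the classes in the union coincide (\<open>quotient_op_residue_class\<close>).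
\<close>

definition quotient_op ::
  "('a \<times> 'a) set \<Rightarrow> ('a list \<Rightarrow> 'g list \<Rightarrow> 'a) \<Rightarrow> 'a set list \<Rightarrow> 'g list \<Rightarrow> 'a set" where
  "quotient_op E \<mu> Xs gs = (\<Union>xs\<in>listset Xs. residue_class E (\<mu> xs gs))"

definition quotient_no_zero_divisors ::
  "nat \<Rightarrow> ('a::comm_monoid_add list \<Rightarrow> 'g::semigroup_add list \<Rightarrow> 'a) \<Rightarrow> ('a \<times> 'a) set \<Rightarrow> bool" where
  "quotient_no_zero_divisors n \<mu> E \<longleftrightarrow>
     (\<forall>xs gs. length xs = n \<and> length gs = n - 1 \<and>
        quotient_op E \<mu> (map (residue_class E) xs) gs = residue_class E 0 \<longrightarrow>
        (\<exists>i<n. residue_class E (xs ! i) = residue_class E 0))"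

lemma in_listset_iff: "ys \<in> listset Xs \<longleftrightarrow> length ys = length Xs \<and> (\<forall>i<length Xs. ys ! i \<in> Xs ! i)"
proof (induction Xs arbitrary: ys)
  case (Cons X Xs)
  then show ?case
    by (cases ys) (auto simp: set_Cons_def nth_Cons less_Suc_eq_0_disj split: nat.splits)
qed auto

lemma quotient_op_residue_class:
  assumes E: "residue_congruence n \<mu> P E" and xs: "length xs = n" and gs: "length gs = n - 1"
  shows "quotient_op E \<mu> (map (residue_class E) xs) gs = residue_class E (\<mu> xs gs)"
proof -
  have eq: "equiv UNIV E" using E by (simp add: residue_congruence_def)
  have "xs \<in> listset (map (residue_class E) xs)"
    using eq by (auto simp: in_listset_iff residue_class_def equiv_def refl_on_def)
  moreover have "residue_class E (\<mu> ys gs) = residue_class E (\<mu> xs gs)"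
    if "ys \<in> listset (map (residue_class E) xs)" for ys
  proof -
    have "(\<mu> xs gs, \<mu> ys gs) \<in> E"
      using E that xs gs by (auto simp: residue_congruence_def in_listset_iff residue_class_def)
    then show ?thesis using eq by (metis equiv_class_eq residue_class_def)
  qed
  ultimately show ?thesis unfolding quotient_op_def by blast
qed

lemma residue_class_eq_zero_iff:
  assumes "residue_congruence n \<mu> P E"
  shows "residue_class E x = residue_class E 0 \<longleftrightarrow> x \<in> P"
proof -
  have "equiv UNIV E" "E `` {0} = P" using assms by (simp_all add: residue_congruence_def)
  then show ?thesis
    unfolding residue_class_def by (metis Image_singleton_iff UNIV_I eq_equiv_class_iff)
qed

context nary_gamma_semiring
begin

lemma zero_in_ideal:
  assumes "two_sided_ideal n \<mu> P" "n \<ge> 2"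
  shows "0 \<in> P"
proof -
  obtain p where p: "p \<in> P" using assms by (auto simp: two_sided_ideal_def)
  define xs where "xs = p # replicate (n - 1) (0::'a)"
  have l: "length xs = n" "xs ! 0 \<in> P" "0 \<in> set xs" "0 < n"
    using assms p by (auto simp: xs_def)
  obtain gs :: "'g list" where gs: "length gs = n - 1" using Ex_list_of_length by blast
  have "\<mu> xs gs \<in> P" using assms(1) l gs unfolding two_sided_ideal_def by blast
  then show ?thesis using absorbing l gs by simp
qed

lemma ex_residue_congruence:
  assumes P: "two_sided_ideal n \<mu> P" and n: "n \<ge> 2"
  shows "\<exists>E. residue_congruence n \<mu> P E"
proof
  let ?E = "{(x, y). x = y \<or> x \<in> P \<and> y \<in> P}"
  have "(\<mu> xs gs, \<mu> ys gs) \<in> ?E"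
    if l: "length xs = n" "length ys = n" "length gs = n - 1"
      and r: "\<forall>i<n. (xs ! i, ys ! i) \<in> ?E" for xs ys gs
  proof (cases "xs = ys")
    case False
    then obtain i where "i < n" "xs ! i \<noteq> ys ! i" using l by (metis nth_equalityI)
    then have "\<exists>i<n. xs ! i \<in> P" "\<exists>i<n. ys ! i \<in> P" using r by auto
    then show ?thesis using P l unfolding two_sided_ideal_def by simp
  qed simp
  moreover have "?E `` {0} = P" using zero_in_ideal[OF P n] by auto
  moreover have "equiv UNIV ?E" by (auto simp: equiv_def refl_on_def sym_def trans_def)
  ultimately show "residue_congruence n \<mu> P ?E" unfolding residue_congruence_def by blast
qed

lemma residue_congruence_bourne:
  assumes P: "two_sided_ideal n \<mu> P" and n: "n \<ge> 2"
    and sub: "\<And>x p. \<lbrakk>x + p \<in> P; p \<in> P\<rbrakk> \<Longrightarrow> x \<in> P"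
  shows "residue_congruence n \<mu> P {(x, y). \<exists>p\<in>P. \<exists>q\<in>P. x + p = y + q}"
    (is "residue_congruence n \<mu> P ?E")
proof -
  have z: "0 \<in> P" using zero_in_ideal[OF P n] .
  have add: "x + y \<in> P" if "x \<in> P" "y \<in> P" for x y
    using P that by (auto simp: two_sided_ideal_def)
  have tr: "(x, w) \<in> ?E" if xy: "(x, y) \<in> ?E" and yw: "(y, w) \<in> ?E" for x y w
  proof -
    obtain p q where 1: "p \<in> P" "q \<in> P" "x + p = y + q" using xy by auto
    obtain r s where 2: "r \<in> P" "s \<in> P" "y + r = w + s" using yw by auto
    have "x + (p + r) = y + q + r" using 1 by (simp add: add.assoc[symmetric])
    also have "\<dots> = y + r + q" by (simp add: ac_simps)
    also have "\<dots> = w + (s + q)" using 2 by (simp add: add.assoc)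
    finally show ?thesis using add 1 2 by blast
  qed
  have rf: "(x, x) \<in> ?E" for x using z by auto
  have eq: "equiv UNIV ?E"
  proof (rule equivI)
    show "refl_on UNIV ?E" using rf by (intro refl_onI)
    show "sym ?E" by (rule symI) (blast intro: sym)
    show "trans ?E" using tr by (intro transI)
  qed simp
  have step: "(\<mu> (xs[i := a]) gs, \<mu> (xs[i := b]) gs) \<in> ?E"
    if l: "length xs = n" "length gs = n - 1" "i < n" and ab: "(a, b) \<in> ?E" for xs gs i a b
  proof -
    obtain p q where pq: "p \<in> P" "q \<in> P" "a + p = b + q" using ab by auto
    have "\<mu> (xs[i := r]) gs \<in> P" if "r \<in> P" for r
    proof -
      have "\<exists>j<n. xs[i := r] ! j \<in> P" using l that by (intro exI[of _ i]) auto
      then show ?thesis using P l unfolding two_sided_ideal_def by simp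
    qed
    moreover have "\<mu> (xs[i := a]) gs + \<mu> (xs[i := p]) gs = \<mu> (xs[i := b]) gs + \<mu> (xs[i := q]) gs"
      using additive[OF l, of a p] additive[OF l, of b q] pq by simp
    ultimately show ?thesis using pq by blast
  qed
  have "(\<mu> xs gs, \<mu> ys gs) \<in> ?E"
    if l: "length xs = n" "length ys = n" "length gs = n - 1"
      and r: "\<forall>i<n. (xs ! i, ys ! i) \<in> ?E" for xs ys gs
  proof -
    have "(\<mu> xs gs, \<mu> (take k ys @ drop k xs) gs) \<in> ?E" if "k \<le> n" for k
      using that
    proof (induction k)
      case 0
      show ?case using rf by simp
    next
      case (Suc k)
      let ?w = "take k ys @ drop k xs"
      have a: "?w[k := xs ! k] = ?w"
        using Suc.prems l by (intro list_update_same_conv[THEN iffD2]) (auto simp: nth_append)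
      have b: "?w[k := ys ! k] = take (Suc k) ys @ drop (Suc k) xs"
        using Suc.prems l
        by (simp add: list_update_append Cons_nth_drop_Suc[symmetric] take_Suc_conv_app_nth)
      have "(\<mu> ?w gs, \<mu> (take (Suc k) ys @ drop (Suc k) xs) gs) \<in> ?E"
        using step[of ?w gs k "xs ! k" "ys ! k"] Suc.prems l r unfolding a b by auto
      then show ?case using Suc tr by (meson Suc_leD)
    qed
    from this[of n] show ?thesis using l by simp
  qed
  moreover have "?E `` {0} = P"
  proof
    show "?E `` {0} \<subseteq> P"
    proof
      fix y assume "y \<in> ?E `` {0}"
      then obtain p q where "p \<in> P" "q \<in> P" "p = y + q" by auto
      then show "y \<in> P" using sub by blast
    qed
    show "P \<subseteq> ?E `` {0}"
    proof
      fix y assume "y \<in> P"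
      moreover have "0 + y = y + 0" by simp
      ultimately show "y \<in> ?E `` {0}" using z by blast
    qed
  qed
  ultimately show ?thesis using eq unfolding residue_congruence_def by blast
qed

end

end

theory Submission
  imports Defs
begin

text \<open>Since the zero class of \<open>E\<close> is \<open>P\<close>, a class vanishes exactly
  when its representative lies in \<open>P\<close>. As the induced operation is computed on
  representatives (\<open>quotient_op_residue_class\<close>), primeness and absence of zero-divisors
  are one implication, read in \<open>T\<close> and in \<open>T/P\<close>.\<close>

theorem theorem4p8:
  fixes n :: nat
    and \<mu> :: "'a::comm_monoid_add list \<Rightarrow> 'g::semigroup_add list \<Rightarrow> 'a"
    and P :: "'a set"
    and E :: "('a \<times> 'a) set"
  assumes "n \<ge> 3"
    and "nary_gamma_semiring n \<mu>"
    and "proper_two_sided_ideal n \<mu> P"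
    and "residue_congruence n \<mu> P E"
  shows "nary_prime n \<mu> P \<longleftrightarrow> quotient_no_zero_divisors n \<mu> E"
proof -
  have "quotient_op E \<mu> (map (residue_class E) xs) gs = residue_class E 0 \<longleftrightarrow> \<mu> xs gs \<in> P"
    if "length xs = n" "length gs = n - 1" for xs gs
    using quotient_op_residue_class[OF assms(4) that] residue_class_eq_zero_iff[OF assms(4)]
    by simp
  \<comment> \<open>Properness, the other half of \<open>nary_prime\<close>, is supplied by
    \<open>assms(3)\<close>; premises and conclusions of the two implications then match.\<close>
  then show ?thesis
    using assms(3) residue_class_eq_zero_iff[OF assms(4)]
    unfolding nary_prime_def quotient_no_zero_divisors_def by metis
qed

end
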